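(* Let $\mathcal{Q}\subseteq\mathcal{H}_{[n]}=(\mathbb{C}^d)^{\otimes n}$ be an $((n,K,\delta))_d$ QECC with normalized projector $\rho_{\mathcal{Q}}$, let $A_j,B_j$ be its Shor-Laflamme weight enumerators and $A_j',B_j'$ its Rains unitary enumerators. Let $p(\mathbf{z})$, $\mathbf{z}\in\mathbb{Z}_2^n$, be the outcome probabilities in the $n$-qubit parallelized SWAP test of $\rho_{\mathcal{Q}}$ and $\rho_{\mathcal{Q}}$. Then for every $0\le j\le n$, $$A_j=\sum_{k=0}^j(-1)^{j-k}\binom{n-k}{j-k}d^k\sum_{\substack{\mathbf{t}\in\mathbb{Z}_2^n\\ \mathrm{wt}(\mathbf{t})=k}}\ \sum_{\mathbf{z}\in\mathbb{Z}_2^n}(-1)^{\mathbf{z}\cdot\mathbf{t}}p(\mathbf{z}),$$ $$B_j=\sum_{k=0}^j(-1)^{j-k}\binom{n-k}{j-k}d^k\sum_{\substack{\mathbf{t}\in\mathbb{Z}_2^n\\ \mathrm{wt}(\mathbf{t})=n-k}}\ \sum_{\mathbf{z}\in\mathbb{Z}_2^n}(-1)^{\mathbf{z}\cdot\mathbf{t}}p(\mathbf{z}),$$ $$A_j'=\sum_{\substack{\mathbf{t}\in\mathbb{Z}_2^n\\ \mathrm{wt}(\mathbf{t})=j}}\ \sum_{\mathbf{z}\in\mathbb{Z}_2^n}(-1)^{\mathbf{z}\cdot\mathbf{t}}p(\mathbf{z}),$$ $$B_j'=\sum_{\substack{\mathbf{t}\in\mathbb{Z}_2^n\\ \mathrm{wt}(\mathbf{t})=n-j}}\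 \sum_{\mathbf{z}\in\mathbb{Z}_2^n}(-1)^{\mathbf{z}\cdot\mathbf{t}}p(\mathbf{z}).$$
   Context: $[n]=\{1,\dots,n\}$; $\mathcal{H}_{[n]}=\bigotimes_{i=1}^n\mathcal{H}_i$ with $\dim\mathcal{H}_i=d$ for all $i$. For $S\subseteq[n]$, $S^c=[n]\setminus S$ and $\rho_S=\mathrm{Tr}_{S^c}\rho$ is the reduced state (partial trace); for $S=\emptyset$, $\mathrm{Tr}(\rho_\emptyset^2)=1$. For $\mathbf{z}\in\mathbb{Z}_2^n$, $\mathrm{supp}(\mathbf{z})=\{i:z_i\ne0\}$, $\mathrm{wt}(\mathbf{z})=|\mathrm{supp}(\mathbf{z})|$, and $\mathbf{u}\cdot\mathbf{v}=\sum_i u_iv_i=|\mathrm{supp}(\mathbf{u})\cap\mathrm{supp}(\mathbf{v})|$. Error basis: let $\{e_j\}_{j\in\mathbb{Z}_{d^2}}$ be an orthogonal basis of the $d\times d$ complex matrices with $\mathrm{Tr}(e_j^\dagger e_{j'})=\delta_{jj'}d$ and containing the identity $I_d$. Let $\mathcal{E}_d=\{E_\alpha\}_{\alpha\in\mathbb{Z}_{d^2}^n}$, $E_\alpha=e_{\alpha_1}\otimes\cdots\otimes e_{\alpha_n}$, $\mathrm{supp}(E_\alpha)=\{i:e_{\alpha_i}\ne I_d\}$, $\mathrm{wt}(E_\alpha)=|\mathrm{supp}(E_\alpha)|$. QECC: a $K$-dimensional subspace $\mathcal{Q}$ of $\mathcal{H}_{[n]}$ is an $((n,K,\delta))_d$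 QECC if for all unit vectors $|\psi\rangle\in\mathcal{Q}$ and all $E_\alpha\in\mathcal{E}_d$ with $\mathrm{wt}(E_\alpha)<\delta$ one has $\langle\psi|E_\alpha|\psi\rangle=C(E_\alpha)$, a constant depending only on $E_\alpha$. It is pure if $C(E_\alpha)=\mathrm{Tr}(E_\alpha)/d^n$; by convention, for $K=1$ an $((n,1,\delta))_d$ QECC is required to be pure. With $\Pi_{\mathcal{Q}}$ the orthogonal projector onto $\mathcal{Q}$, the normalized projector is $\rho_{\mathcal{Q}}=\Pi_{\mathcal{Q}}/K$. The Shor-Laflamme weight enumerators are $$A_j=\sum_{\mathrm{wt}(E_\alpha)=j}\mathrm{Tr}(E_\alpha\rho_{\mathcal{Q}})\mathrm{Tr}(E_\alpha^\dagger\rho_{\mathcal{Q}}),\qquad B_j=\sum_{\mathrm{wt}(E_\alpha)=j}\mathrm{Tr}(E_\alpha\rho_{\mathcal{Q}}E_\alpha^\dagger\rho_{\mathcal{Q}}),$$ (sums over $E_\alpha\in\mathcal{E}_d$), and the Rains unitary enumerators are $$A_j'=\sum_{T\subseteq[n],|T|=j}\mathrm{Tr}[(\rho_{\mathcal{Q}})_T^2],\qquad B_j'=\sum_{T\subseteq[n],|T|=j}\mathrm{Tr}[(\rho_{\mathcal{Q}})_{T^c}^2].$$ The $n$-qubit parallelized SWAP test of states $\rho$ and $\sigma$ on $\mathcal{H}_{[n]}$ is the following circuit. There are $n$ ancilla qubits $A_1,\dots,A_n$, and registers $B_1,\dots,B_n$ and $C_1,\dots,C_n$ with $B_i\cong C_i\cong\mathcal{H}_i$.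 The initial state is $(|0\rangle\langle 0|)^{\otimes n}\otimes\rho\otimes\sigma$, with $\rho$ on $B_1\cdots B_n$ and $\sigma$ on $C_1\cdots C_n$. Apply a Hadamard gate $H$ to each ancilla $A_i$; then for each $i$ apply the controlled-SWAP gate with control $A_i$ which swaps $B_i$ and $C_i$ when $A_i$ is in state $|1\rangle$ (and acts trivially when $A_i$ is in state $|0\rangle$); then apply $H$ to each ancilla again; finally measure all ancillas in the computational basis. $p(\mathbf{z})$ denotes the probability of obtaining outcome $\mathbf{z}\in\mathbb{Z}_2^n$. (The circuit registers $A_i,B_i$ are unrelated to the enumerators $A_j,B_j$.) *)

theory Defs
  imports "HOL-Analysis.Analysis"
begin

text \<open>
  The sites form an arbitrary finite type \<open>'n\<close>, so that \<open>n = CARD('n)\<close>, and the local space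
  is \<open>complex ^ 'd\<close> with \<open>d = CARD('d)\<close>. The computational basis of the \<open>n\<close>-fold tensor power
  is indexed by the functions \<open>'n \<Rightarrow> 'd\<close>. A bit string in \<open>Z_2^n\<close> is a function
  \<open>'n \<Rightarrow> bool\<close>, where \<open>True\<close> is the bit 1.
\<close>

type_synonym 'm op = "complex ^ 'm ^ 'm"
type_synonym ('n, 'd) hilb = "complex ^ ('n \<Rightarrow> 'd)"

definition cinner :: "complex ^ 'm \<Rightarrow> complex ^ 'm \<Rightarrow> complex" where
  "cinner u v = (\<Sum>i\<in>UNIV. cnj (u $ i) * v $ i)"

definition adjoint_op :: "('m::finite) op \<Rightarrow> 'm op" where
  "adjoint_op A = (\<chi> x y. cnj (A $ y $ x))"

definition kron :: "('a::finite) op \<Rightarrow> ('b::finite) op \<Rightarrow> ('a \<times> 'b) op" where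
  "kron A B = (\<chi> x y. A $ fst x $ fst y * B $ snd x $ snd y)"

definition tensor_op :: "('n::finite \<Rightarrow> ('a::finite) op) \<Rightarrow> ('n \<Rightarrow> 'a) op" where
  "tensor_op M = (\<chi> x y. \<Prod>i\<in>UNIV. M i $ x i $ y i)"

definition orth_projector :: "(complex ^ 'm) set \<Rightarrow> ('m::finite) op" where
  "orth_projector Q = (THE P. \<forall>v. P *v v \<in> Q \<and> (\<forall>u\<in>Q. cinner u (v - P *v v) = 0))"

lemma cinner_add_right: "cinner u (v + w) = cinner u v + cinner u w"
  by (simp add: cinner_def algebra_simps sum.distrib)

lemma cinner_diff_right: "cinner u (v - w) = cinner u v - cinner u w"
  by (simp add: cinner_def algebra_simps sum_subtractf)

lemma cinner_scale_right: "cinner u (c *s v) = c * cinner u v"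
  by (simp add: cinner_def algebra_simps sum_distrib_left)

lemma cinner_scale_left: "cinner (c *s u) v = cnj c * cinner u v"
  by (simp add: cinner_def algebra_simps sum_distrib_left)

lemma cinner_self_eq_0: "cinner v v = 0 \<longleftrightarrow> v = 0"
proof
  assume "cinner v v = 0"
  moreover have "cinner v v = complex_of_real (\<Sum>i\<in>UNIV. (cmod (v $ i))\<^sup>2)"
    unfolding cinner_def of_real_sum
    by (intro sum.cong refl) (subst complex_norm_square, rule mult.commute)
  ultimately have "(\<Sum>i\<in>UNIV. (cmod (v $ i))\<^sup>2) = 0"
    by (metis of_real_eq_0_iff)
  then show "v = 0"
    by (simp add: sum_nonneg_eq_0_iff vec_eq_iff)
qed (simp add: cinner_def)

lemma Re_cinner: "Re (cinner u v) = u \<bullet> v"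
  by (simp add: cinner_def inner_vec_def inner_complex_def)

text \<open>The description in \<^const>\<open>orth_projector\<close> determines a matrix.\<close>

lemma orth_projector_ex1:
  fixes Q :: "(complex ^ 'm::finite) set"
  assumes Q: "vec.subspace Q"
  shows "\<exists>!P. \<forall>v. P *v v \<in> Q \<and> (\<forall>u\<in>Q. cinner u (v - P *v v) = 0)"
proof -
  have scaleR: "c *\<^sub>R v = complex_of_real c *s v" for c and v :: "complex ^ 'm"
    unfolding vec_eq_iff vector_scaleR_component vector_smult_component by (simp add: scaleR_conv_of_real)
  have "subspace Q"
    using Q unfolding subspace_def vec.subspace_def scaleR by blast
  then have span: "span Q = Q"
    by (simp add: span_eq_iff)
  have uniq: "y = y'"
    if "y \<in> Q" "y' \<in> Q" "\<forall>u\<in>Q. cinner u (v - y) = 0" "\<forall>u\<in>Q. cinner u (v - y') = 0" for v y y'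
  proof -
    have "y - y' \<in> Q"
      using that Q by (simp add: vec.subspace_diff)
    then have "cinner (y - y') (y - y') = 0"
      using that by (simp add: cinner_diff_right)
    then show ?thesis
      by (simp add: cinner_self_eq_0)
  qed
  have ex: "\<exists>y\<in>Q. \<forall>u\<in>Q. cinner u (v - y) = 0" for v
  proof -
    obtain y z where yz: "y \<in> Q" "\<And>w. w \<in> Q \<Longrightarrow> orthogonal z w" "v = y + z"
      using orthogonal_subspace_decomp_exists[of Q v] span by metis
    have "cinner u z = 0" if "u \<in> Q" for u
    proof (rule complex_eqI)
      show "Re (cinner u z) = Re 0"
        using yz(2)[OF that] by (simp add: Re_cinner orthogonal_def inner_commute)
      have "\<i> *s u \<in> Q"
        using that Q by (simp add: vec.subspace_scale)
      from yz(2)[OF this] have "Re (cinner (\<i> *s u) z) = 0"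
        by (simp add: Re_cinner orthogonal_def inner_commute)
      then show "Im (cinner u z) = Im 0"
        by (simp add: cinner_scale_left)
    qed
    moreover have "v - y = z"
      using yz(3) by simp
    ultimately show ?thesis
      using yz(1) by metis
  qed
  then obtain p where p: "\<And>v. p v \<in> Q" "\<And>v u. u \<in> Q \<Longrightarrow> cinner u (v - p v) = 0"
    by metis
  have "Vector_Spaces.linear (*s) (*s) p"
  proof (unfold_locales)
    fix x y :: "complex ^ 'm" and c :: complex
    show "p (x + y) = p x + p y"
    proof (rule uniq[of _ _ "x + y"])
      show "\<forall>u\<in>Q. cinner u (x + y - (p x + p y)) = 0"
        by (simp add: add_diff_add cinner_add_right p(2))
    qed (use p Q in \<open>auto simp: vec.subspace_add\<close>)
    show "p (c *s x) = c *s p x"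
    proof (rule uniq[of _ _ "c *s x"])
      show "\<forall>u\<in>Q. cinner u (c *s x - c *s p x) = 0"
        unfolding vec.scale_right_diff_distrib[symmetric] cinner_scale_right by (simp add: p(2))
    qed (use p Q in \<open>auto simp: vec.subspace_scale\<close>)
  qed
  then have P: "matrix p *v v = p v" for v
    by (rule matrix_works)
  show ?thesis
  proof (rule ex1I[of _ "matrix p"])
    show "\<forall>v. matrix p *v v \<in> Q \<and> (\<forall>u\<in>Q. cinner u (v - matrix p *v v) = 0)"
      using p by (simp add: P)
    fix P' :: "'m op"
    assume "\<forall>v. P' *v v \<in> Q \<and> (\<forall>u\<in>Q. cinner u (v - P' *v v) = 0)"
    then have "P' *v v = matrix p *v v" for v
      using uniq[of "P' *v v" "p v" v] p by (simp add: P)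
    then show "P' = matrix p"
      by (simp add: matrix_eq)
  qed
qed

definition is_error_basis :: "(nat \<Rightarrow> ('d::finite) op) \<Rightarrow> bool" where
  "is_error_basis e \<longleftrightarrow>
     (\<forall>j<CARD('d)\<^sup>2. \<forall>j'<CARD('d)\<^sup>2.
        trace (adjoint_op (e j) ** e j') = (if j = j' then of_nat CARD('d) else 0)) \<and>
     (\<forall>M. \<exists>c::nat \<Rightarrow> complex. \<forall>x y. M $ x $ y = (\<Sum>j<CARD('d)\<^sup>2. c j * e j $ x $ y)) \<and>
     (\<exists>j<CARD('d)\<^sup>2. e j = mat 1)"

definition err :: "(nat \<Rightarrow> ('d::finite) op) \<Rightarrow> ('n::finite \<Rightarrow> nat) \<Rightarrow> ('n \<Rightarrow> 'd) op" where
  "err e \<alpha> = tensor_op (\<lambda>i. e (\<alpha> i))"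

definition err_wt :: "(nat \<Rightarrow> ('d::finite) op) \<Rightarrow> ('n::finite \<Rightarrow> nat) \<Rightarrow> nat" where
  "err_wt e \<alpha> = card {i. e (\<alpha> i) \<noteq> mat 1}"

text \<open>
  The parameter \<open>K\<close> is positive because the projector gets divided by it. One-dimensional codes
  are required to be pure by convention.
\<close>

definition is_qecc ::
  "(nat \<Rightarrow> ('d::finite) op) \<Rightarrow> ('n::finite, 'd) hilb set \<Rightarrow> nat \<Rightarrow> nat \<Rightarrow> bool" where
  "is_qecc e Q K \<delta> \<longleftrightarrow>
     vec.subspace Q \<and> vec.dim Q = K \<and> K > 0 \<and>
     (\<exists>C :: ('n \<Rightarrow> 'd) op \<Rightarrow> complex.
        (\<forall>\<psi>\<in>Q. \<forall>\<alpha>. norm \<psi> = 1 \<and> (\<forall>i. \<alpha> i < CARD('d)\<^sup>2) \<and> err_wt e \<alpha> < \<delta> \<longrightarrow>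
           cinner \<psi> (err e \<alpha> *v \<psi>) = C (err e \<alpha>)) \<and>
        (K = 1 \<longrightarrow>
           (\<forall>\<alpha>. (\<forall>i. \<alpha> i < CARD('d)\<^sup>2) \<and> err_wt e \<alpha> < \<delta> \<longrightarrow>
              C (err e \<alpha>) = trace (err e \<alpha>) / of_nat CARD('d) ^ CARD('n))))"

definition normalized_projector :: "(complex ^ 'm) set \<Rightarrow> ('m::finite) op" where
  "normalized_projector Q = (1 / real (vec.dim Q)) *\<^sub>R orth_projector Q"

definition SL_A :: "(nat \<Rightarrow> ('d::finite) op) \<Rightarrow> ('n::finite \<Rightarrow> 'd) op \<Rightarrow> nat \<Rightarrow> complex" where
  "SL_A e \<rho> j = (\<Sum>\<alpha> | (\<forall>i. \<alpha> i < CARD('d)\<^sup>2) \<and> err_wt e \<alpha> = j.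
     trace (err e \<alpha> ** \<rho>) * trace (adjoint_op (err e \<alpha>) ** \<rho>))"

definition SL_B :: "(nat \<Rightarrow> ('d::finite) op) \<Rightarrow> ('n::finite \<Rightarrow> 'd) op \<Rightarrow> nat \<Rightarrow> complex" where
  "SL_B e \<rho> j = (\<Sum>\<alpha> | (\<forall>i. \<alpha> i < CARD('d)\<^sup>2) \<and> err_wt e \<alpha> = j.
     trace (err e \<alpha> ** \<rho> ** adjoint_op (err e \<alpha>) ** \<rho>))"

text \<open>
  The space of the sites in \<open>T\<close> depends on the set \<open>T\<close>, so operators on it are kernels over the
  basis labels \<open>T \<rightarrow>\<^sub>E UNIV\<close> and not matrices over a type. For \<open>T = {}\<close> there is a single label,
  and the reduced state of a state is the scalar 1.
\<close>

definition join :: "'n set \<Rightarrow> ('n \<Rightarrow> 'd) \<Rightarrow> ('n \<Rightarrow> 'd) \<Rightarrow> 'n \<Rightarrow> 'd" where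
  "join T x w = (\<lambda>i. if i \<in> T then x i else w i)"

definition reduced ::
  "('n::finite \<Rightarrow> 'd::finite) op \<Rightarrow> 'n set \<Rightarrow> ('n \<Rightarrow> 'd) \<Rightarrow> ('n \<Rightarrow> 'd) \<Rightarrow> complex" where
  "reduced \<rho> T x y = (\<Sum>w\<in>(- T) \<rightarrow>\<^sub>E UNIV. \<rho> $ join T x w $ join T y w)"

definition purity :: "('n::finite \<Rightarrow> 'd::finite) op \<Rightarrow> 'n set \<Rightarrow> complex" where
  "purity \<rho> T = (\<Sum>x\<in>T \<rightarrow>\<^sub>E UNIV. \<Sum>y\<in>T \<rightarrow>\<^sub>E UNIV. reduced \<rho> T x y * reduced \<rho> T y x)"

definition rains_A :: "('n::finite \<Rightarrow> 'd::finite) op \<Rightarrow> nat \<Rightarrow> complex" where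
  "rains_A \<rho> j = (\<Sum>T | card T = j. purity \<rho> T)"

definition rains_B :: "('n::finite \<Rightarrow> 'd::finite) op \<Rightarrow> nat \<Rightarrow> complex" where
  "rains_B \<rho> j = (\<Sum>T | card T = j. purity \<rho> (- T))"

definition wt :: "('n::finite \<Rightarrow> bool) \<Rightarrow> nat" where
  "wt z = card {i. z i}"

definition dot :: "('n::finite \<Rightarrow> bool) \<Rightarrow> ('n \<Rightarrow> bool) \<Rightarrow> nat" where
  "dot u v = card ({i. u i} \<inter> {i. v i})"

definition hadamard :: "bool op" where
  "hadamard = (\<chi> a b. (if a \<and> b then - 1 else 1) / complex_of_real (sqrt 2))"

definition basis_proj :: "bool \<Rightarrow> bool op" where
  "basis_proj b = (\<chi> x y. if x = b \<and> y = b then 1 else 0)"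

definition cswap_map :: "bool \<times> 'd \<times> 'd \<Rightarrow> bool \<times> 'd \<times> 'd" where
  "cswap_map = (\<lambda>(a, b, c). if a then (a, c, b) else (a, b, c))"

definition cswap :: "(bool \<times> 'd \<times> 'd::finite) op" where
  "cswap = (\<chi> x y. if x = cswap_map y then 1 else 0)"

text \<open>
  The circuit acts on \<open>A_1 ... A_n B_1 ... B_n C_1 ... C_n\<close>, with basis labels the triples of
  functions \<open>(a, b, c)\<close>. The gates \<open>cswap\<close> of the different sites act on the disjoint triples
  of registers \<open>A_i B_i C_i\<close>, so applying all of them is their tensor product over the sites.
\<close>

type_synonym ('n, 'd) circ = "('n \<Rightarrow> bool) \<times> ('n \<Rightarrow> 'd) \<times> ('n \<Rightarrow> 'd)"

definition registers :: "('n, 'd) circ \<Rightarrow> 'n \<Rightarrow> bool \<times> 'd \<times> 'd" where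
  "registers = (\<lambda>(a, b, c) i. (a i, b i, c i))"

definition cswap_layer :: "('n::finite, 'd::finite) circ op" where
  "cswap_layer = (\<chi> x y. \<Prod>i\<in>UNIV. cswap $ registers x i $ registers y i)"

definition hadamard_layer :: "('n::finite, 'd::finite) circ op" where
  "hadamard_layer = kron (tensor_op (\<lambda>_. hadamard)) (mat 1)"

definition swap_test_initial ::
  "('n::finite \<Rightarrow> 'd::finite) op \<Rightarrow> ('n \<Rightarrow> 'd) op \<Rightarrow> ('n, 'd) circ op" where
  "swap_test_initial \<rho> \<sigma> = kron (tensor_op (\<lambda>_. basis_proj False)) (kron \<rho> \<sigma>)"

definition swap_test_unitary :: "('n::finite, 'd::finite) circ op" where
  "swap_test_unitary = hadamard_layer ** cswap_layer ** hadamard_layer"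

definition swap_test_final ::
  "('n::finite \<Rightarrow> 'd::finite) op \<Rightarrow> ('n \<Rightarrow> 'd) op \<Rightarrow> ('n, 'd) circ op" where
  "swap_test_final \<rho> \<sigma> =
     swap_test_unitary ** swap_test_initial \<rho> \<sigma> ** adjoint_op swap_test_unitary"

text \<open>
  Born's rule. For states \<open>\<rho>\<close> and \<open>\<sigma>\<close> the trace is a nonnegative real number.
\<close>

definition swap_test_prob ::
  "('n::finite \<Rightarrow> 'd::finite) op \<Rightarrow> ('n \<Rightarrow> 'd) op \<Rightarrow> ('n \<Rightarrow> bool) \<Rightarrow> real" where
  "swap_test_prob \<rho> \<sigma> z =
     Re (trace (kron (tensor_op (\<lambda>i. basis_proj (z i))) (mat 1) ** swap_test_final \<rho> \<sigma>))"

end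

theory Submission
  imports Defs
begin

text \<open>
  Let \<open>S(T)\<close> be the trace of \<open>\<rho> \<otimes> \<sigma>\<close> times the operator swapping the two copies at the sites in
  \<open>T\<close>. Expanding the two Hadamard layers, the outcome distribution of the swap test is the Walsh
  transform of \<open>S\<close> divided by \<open>2^n\<close>, so inverting the transform returns \<open>S\<close>. For \<open>\<sigma> = \<rho>\<close> the value
  \<open>S(T)\<close> is the purity of the reduced state on \<open>T\<close>, which gives the unitary enumerators. Completeness
  of the error basis says that summing \<open>e_j\<close> tensored with its conjugate over all \<open>j\<close> yields \<open>d\<close>
  times a swap; hence the terms of \<open>A\<close> (of \<open>B\<close>) over all errors supported within \<open>T\<close> add up to
  \<open>d^|T| S(T)\<close> (to \<open>d^|T| S(T^c)\<close>), and Moebius inversion over subsets isolates the errors of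
  weight \<open>j\<close>.
\<close>

section \<open>Finite sums and products of conditional terms\<close>

lemma prod_if_zero:
  fixes f :: "'a \<Rightarrow> 'b::comm_semiring_1"
  assumes "finite A"
  shows "(\<Prod>i\<in>A. if P i then f i else 0) = (if \<forall>i\<in>A. P i then prod f A else 0)"
  using assms by (induction A rule: finite_induct) auto

lemma sum_UNIV_prod:
  "(\<Sum>x\<in>(UNIV :: ('a::finite \<times> 'b::finite) set). f x) = (\<Sum>a\<in>UNIV. \<Sum>b\<in>UNIV. f (a, b))"
  by (simp add: sum.cartesian_product UNIV_Times_UNIV[symmetric] del: UNIV_Times_UNIV)

lemma sum_fun_prod:
  fixes f :: "'n::finite \<Rightarrow> 'a::finite \<Rightarrow> 'b::comm_semiring_1"
  shows "(\<Sum>g\<in>UNIV. \<Prod>i\<in>UNIV. f i (g i)) = (\<Prod>i\<in>UNIV. \<Sum>x\<in>UNIV. f i x)"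
  by (subst prod_sum_PiE) auto

lemma mult_if_zero:
  fixes x y :: "'a::semiring_0"
  shows "(if P then x else 0) * y = (if P then x * y else 0)"
    and "y * (if P then x else 0) = (if P then y * x else 0)"
  by auto

lemma divide_if_zero: "(if P then x else 0) / y = (if P then x / y else 0)"
  for x y :: "'a::division_ring"
  by simp

text \<open>Nesting exposes one equation at a time, so that sums with a single nonzero term collapse
  in turn.\<close>

lemma if_conj_zero: "(if P \<and> Q then x else 0) = (if P then if Q then x else 0 else 0)"
  by simp

lemma sum_if_zero: "(\<Sum>x\<in>A. if P then f x else 0) = (if P then sum f A else 0)"
  by simp

lemma kron_nth: "kron A B $ (a, b) $ (a', b') = A $ a $ a' * B $ b $ b'"
  by (simp add: kron_def)

section \<open>Swapping two copies on a set of sites\<close>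

definition partial_swap :: "'n set \<Rightarrow> ('n \<Rightarrow> 'd) \<times> ('n \<Rightarrow> 'd) \<Rightarrow> ('n \<Rightarrow> 'd) \<times> ('n \<Rightarrow> 'd)" where
  "partial_swap T bc = (join T (snd bc) (fst bc), join T (fst bc) (snd bc))"

definition swap_trace :: "('n::finite \<Rightarrow> 'd::finite) op \<Rightarrow> ('n \<Rightarrow> 'd) op \<Rightarrow> 'n set \<Rightarrow> complex" where
  "swap_trace \<rho> \<sigma> T = (\<Sum>bc\<in>UNIV. kron \<rho> \<sigma> $ bc $ partial_swap T bc)"

text \<open>Swaps at distinct sites commute and each squares to the identity, so composing them adds
  the sets of sites in \<open>Z_2^n\<close>.\<close>

lemma partial_swap_partial_swap: "partial_swap S (partial_swap T bc) = partial_swap (sym_diff S T) bc"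
  by (auto simp: partial_swap_def join_def fun_eq_iff)

lemma partial_swap_empty [simp]: "partial_swap {} bc = bc"
  by (auto simp: partial_swap_def join_def fun_eq_iff)

lemma partial_swap_involution [simp]: "partial_swap T (partial_swap T bc) = bc"
  by (simp add: partial_swap_partial_swap)

lemma sum_partial_swap:
  fixes f :: "('n::finite \<Rightarrow> 'd::finite) \<times> ('n \<Rightarrow> 'd) \<Rightarrow> 'a::comm_monoid_add"
  shows "(\<Sum>bc\<in>UNIV. f (partial_swap T bc)) = (\<Sum>bc\<in>UNIV. f bc)"
  by (rule sum.reindex_bij_witness[of _ "partial_swap T" "partial_swap T"]) auto

lemma swap_trace_explicit:
  "swap_trace \<rho> \<sigma> T = (\<Sum>b\<in>UNIV. \<Sum>c\<in>UNIV. \<rho> $ b $ join T c b * \<sigma> $ c $ join T b c)"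
  by (simp add: swap_trace_def sum_UNIV_prod kron_def partial_swap_def)

text \<open>Conjugating a self-adjoint matrix exchanges row and column labels. As the partial swap
  is an involution, reindexing by it restores the original sum.\<close>

lemma swap_trace_real:
  assumes "adjoint_op \<rho> = \<rho>" "adjoint_op \<sigma> = \<sigma>"
  shows "complex_of_real (Re (swap_trace \<rho> \<sigma> T)) = swap_trace \<rho> \<sigma> T"
proof -
  have cnj: "cnj (\<rho> $ x $ y) = \<rho> $ y $ x" "cnj (\<sigma> $ x $ y) = \<sigma> $ y $ x" for x y
    using assms by (auto simp: adjoint_op_def vec_eq_iff)
  have "cnj (swap_trace \<rho> \<sigma> T) = (\<Sum>bc\<in>UNIV. kron \<rho> \<sigma> $ partial_swap T bc $ partial_swap T (partial_swap T bc))"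
    by (simp add: swap_trace_def kron_def cnj)
  also have "\<dots> = swap_trace \<rho> \<sigma> T"
    unfolding swap_trace_def
    by (rule sum_partial_swap[where f = "\<lambda>bc. kron \<rho> \<sigma> $ bc $ partial_swap T bc"])
  finally show ?thesis
    by (metis Reals_cnj_iff of_real_Re)
qed

text \<open>A label splits into its parts on and off \<open>T\<close>. The inverse is
  \<open>restrict\<close>, which gives each part the value \<open>undefined\<close> outside its own
  set, as extensional functions require.\<close>

lemma sum_join:
  fixes f :: "('n::finite \<Rightarrow> 'd::finite) \<Rightarrow> 'a::comm_monoid_add"
  shows "(\<Sum>b\<in>UNIV. f b) = (\<Sum>x\<in>T \<rightarrow>\<^sub>E UNIV. \<Sum>w\<in>(- T) \<rightarrow>\<^sub>E UNIV. f (join T x w))"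
proof -
  have "(\<Sum>b\<in>UNIV. f b) = (\<Sum>(x, w)\<in>(T \<rightarrow>\<^sub>E UNIV) \<times> ((- T) \<rightarrow>\<^sub>E UNIV). f (join T x w))"
    by (rule sum.reindex_bij_witness[of _ "\<lambda>(x, w). join T x w" "\<lambda>b. (restrict b T, restrict b (- T))"])
      (auto simp: join_def fun_eq_iff PiE_def extensional_def restrict_def
        intro!: arg_cong[where f = f])
  then show ?thesis
    by (simp add: sum.cartesian_product)
qed

text \<open>Write \<open>b\<close> as \<open>join T x w\<close> and \<open>c\<close> as
  \<open>join T y w'\<close>. The swap exchanges \<open>x\<close> and \<open>y\<close> and fixes
  \<open>w\<close> and \<open>w'\<close>, so summing over \<open>w\<close> and \<open>w'\<close>
  traces out the complement of \<open>T\<close> in each copy.\<close>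

lemma purity_eq_swap_trace: "purity \<rho> T = swap_trace \<rho> \<rho> T"
proof -
  have j: "join T (join T y w') (join T x w) = join T y w" for x y w w' :: "'a \<Rightarrow> 'b"
    by (auto simp: join_def)
  have "swap_trace \<rho> \<rho> T =
    (\<Sum>x\<in>T \<rightarrow>\<^sub>E UNIV. \<Sum>w\<in>(- T) \<rightarrow>\<^sub>E UNIV. \<Sum>y\<in>T \<rightarrow>\<^sub>E UNIV. \<Sum>w'\<in>(- T) \<rightarrow>\<^sub>E UNIV.
      \<rho> $ join T x w $ join T y w * \<rho> $ join T y w' $ join T x w')"
    by (simp add: swap_trace_explicit sum_join[where T = T] j)
  also have "\<dots> = (\<Sum>x\<in>T \<rightarrow>\<^sub>E UNIV. \<Sum>y\<in>T \<rightarrow>\<^sub>E UNIV. \<Sum>w\<in>(- T) \<rightarrow>\<^sub>E UNIV. \<Sum>w'\<in>(- T) \<rightarrow>\<^sub>E UNIV.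
      \<rho> $ join T x w $ join T y w * \<rho> $ join T y w' $ join T x w')"
    by (intro sum.cong refl sum.swap)
  also have "\<dots> = purity \<rho> T"
    by (simp add: purity_def reduced_def sum_product)
  finally show ?thesis by simp
qed

section \<open>Self-adjointness of the normalized projector\<close>

text \<open>The residual \<open>v - P *v v\<close> is orthogonal to \<open>P *v u\<close>, so
  pairing \<open>P *v u\<close> with \<open>v\<close> is the same as pairing it with
  \<open>P *v v\<close>, which treats both vectors alike up to conjugation. Basis vectors then yield
  the entries.\<close>

lemma adjoint_orth_projector:
  fixes Q :: "(complex ^ 'm::finite) set"
  assumes "vec.subspace Q"
  shows "adjoint_op (orth_projector Q) = orth_projector Q"
proof -
  define P where "P = orth_projector Q"
  have P: "P *v v \<in> Q" "u \<in> Q \<Longrightarrow> cinner u (v - P *v v) = 0" for u v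
    using theI'[OF orth_projector_ex1[OF assms]] unfolding P_def orth_projector_def by auto
  have c: "cnj (cinner u v) = cinner v u" for u v :: "complex ^ 'm"
    by (simp add: cinner_def mult.commute)
  have 1: "cinner (P *v u) v = cinner (P *v u) (P *v v)" for u v
    using P(2)[OF P(1), of u v] by (simp add: cinner_diff_right)
  have 2: "cinner (P *v u) v = cinner u (P *v v)" for u v
    by (metis 1 c)
  have "cnj (P $ y $ x) = P $ x $ y" for x y
    using 2[of "axis x 1" "axis y 1"]
    by (simp add: cinner_def matrix_vector_mult_def axis_def if_distrib[of cnj]
        if_distrib[of "(*) _"] if_distrib[of "\<lambda>x. x * _"] cong: if_cong)
  then show ?thesis
    by (simp add: adjoint_op_def vec_eq_iff P_def)
qed

lemma adjoint_normalized_projector: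
  assumes "vec.subspace Q"
  shows "adjoint_op (normalized_projector Q) = normalized_projector Q"
  using adjoint_orth_projector[OF assms]
  by (simp add: adjoint_op_def normalized_projector_def vec_eq_iff)

section \<open>Walsh characters\<close>

text \<open>The product form of the character \<open>(-1)^(z . s)\<close> matches the Hadamard
  tensor power and lets sums over bit strings factor over the sites.\<close>

definition walsh :: "('n::finite \<Rightarrow> bool) \<Rightarrow> ('n \<Rightarrow> bool) \<Rightarrow> complex" where
  "walsh z s = (\<Prod>i\<in>UNIV. if z i \<and> s i then -1 else 1)"

lemma walsh_eq_dot: "walsh z s = (-1) ^ dot z s"
  by (simp add: walsh_def dot_def prod.If_cases Collect_conj_eq)

text \<open>The sum factors; the factor at site \<open>i\<close> is
  \<open>1 + (-1)^(s_i + t_i)\<close>.\<close>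

lemma walsh_orthogonal:
  "(\<Sum>z\<in>UNIV. walsh z s * walsh z t) = (if s = t then 2 ^ CARD('n) else 0)"
  for s t :: "'n::finite \<Rightarrow> bool"
proof -
  have "(\<Sum>z\<in>UNIV. walsh z s * walsh z t) =
    (\<Prod>i\<in>UNIV. \<Sum>b\<in>UNIV. (if b \<and> s i then -1 else 1) * (if b \<and> t i then -1 else 1))"
    unfolding walsh_def prod.distrib[symmetric] by (rule sum_fun_prod)
  also have "\<dots> = (\<Prod>i\<in>UNIV. if s i = t i then 2 else 0)"
    by (intro prod.cong refl) (auto simp: UNIV_bool)
  also have "\<dots> = (if s = t then 2 ^ CARD('n::finite) else 0)"
    by (simp add: prod_if_zero fun_eq_iff)
  finally show ?thesis .
qed

lemma walsh_mult: "walsh z s * walsh z t = walsh z (\<lambda>i. s i \<noteq> t i)"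
  unfolding walsh_def prod.distrib[symmetric] by (intro prod.cong) auto

lemma walsh_zero [simp]: "walsh z (\<lambda>_. False) = 1"
  by (simp add: walsh_def)

lemma cnj_walsh [simp]: "cnj (walsh z s) = walsh z s"
  by (simp add: walsh_eq_dot)

section \<open>Outcome distribution of the swap test\<close>

lemma hadamard_tensor_nth:
  "tensor_op (\<lambda>_. hadamard) $ z $ s = walsh z s / complex_of_real (sqrt 2) ^ CARD('n)"
  for z s :: "'n::finite \<Rightarrow> bool"
proof -
  have "tensor_op (\<lambda>_. hadamard) $ z $ s =
      (\<Prod>i\<in>UNIV. (if z i \<and> s i then -1 else 1) / complex_of_real (sqrt 2))"
    by (simp add: tensor_op_def hadamard_def)
  then show ?thesis
    unfolding walsh_def by (simp add: prod_dividef)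
qed

lemma hadamard_layer_nth:
  "hadamard_layer $ (a, bc) $ (a', bc') =
    (if bc = bc' then walsh a a' / complex_of_real (sqrt 2) ^ CARD('n) else 0)"
  for a a' :: "'n::finite \<Rightarrow> bool"
  by (simp add: hadamard_layer_def kron_def hadamard_tensor_nth mat_def)

lemma cswap_layer_nth:
  "cswap_layer $ (a, bc) $ (a', bc') =
    (if a = a' \<and> bc = partial_swap {i. a' i} bc' then 1 else 0)"
proof -
  obtain b c b' c' where bc: "bc = (b, c)" "bc' = (b', c')" by fastforce
  have "cswap_layer $ (a, bc) $ (a', bc') =
    (if \<forall>i. (a i, b i, c i) = cswap_map (a' i, b' i, c' i) then 1 else 0)"
    by (simp add: bc cswap_layer_def cswap_def registers_def prod_if_zero)
  also have "(\<forall>i. (a i, b i, c i) = cswap_map (a' i, b' i, c' i)) \<longleftrightarrow>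
      a = a' \<and> bc = partial_swap {i. a' i} bc'"
  proof -
    have "(a i, b i, c i) = cswap_map (a' i, b' i, c' i) \<longleftrightarrow>
        a i = a' i \<and> b i = join {i. a' i} c' b' i \<and> c i = join {i. a' i} b' c' i" for i
      by (simp add: cswap_map_def join_def)
    then show ?thesis
      by (simp add: bc partial_swap_def fun_eq_iff all_conj_distrib)
  qed
  finally show ?thesis .
qed

lemma sum_circ:
  fixes f :: "('n::finite, 'd::finite) circ \<Rightarrow> 'a::comm_monoid_add"
  shows "(\<Sum>x\<in>UNIV. f x) = (\<Sum>a\<in>UNIV. \<Sum>bc\<in>UNIV. f (a, bc))"
  by (rule sum_UNIV_prod)

text \<open>The all-zero ancilla column suffices because the initial state is supported there. In it
  the first Hadamard layer has constant sign, and the two layers together contribute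
  \<open>1 / 2^n\<close>.\<close>

lemma swap_test_unitary_nth:
  "swap_test_unitary $ (a, bc) $ ((\<lambda>_. False), bc0) =
    (\<Sum>a'\<in>UNIV. if bc0 = partial_swap {i. a' i} bc then walsh a a' / 2 ^ CARD('n) else 0)"
  for a :: "'n::finite \<Rightarrow> bool" and bc bc0 :: "('n \<Rightarrow> 'd::finite) \<times> ('n \<Rightarrow> 'd)"
proof -
  let ?s = "complex_of_real (sqrt 2) ^ CARD('n)"
  have s: "?s * ?s = 2 ^ CARD('n)"
    by (simp flip: power_mult_distrib of_real_mult)
  \<comment> \<open>The involution solves the condition for the column label, over which the next
    matrix product sums.\<close>
  have swap: "bc = partial_swap S bc' \<longleftrightarrow> bc' = partial_swap S bc" for S bc'
    by auto
  have hc: "(hadamard_layer ** cswap_layer) $ (a, bc) $ (a', bc') =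
      (if bc' = partial_swap {i. a' i} bc then walsh a a' / ?s else 0)"
    for a' and bc' :: "('n \<Rightarrow> 'd) \<times> ('n \<Rightarrow> 'd)"
    unfolding matrix_matrix_mult_def sum_circ
    by (simp add: hadamard_layer_nth cswap_layer_nth mult_if_zero divide_if_zero if_conj_zero sum_if_zero
        swap cong: if_cong)
  show ?thesis
    unfolding swap_test_unitary_def matrix_matrix_mult_def[of "_ ** _"] sum_circ
    by (simp add: hc hadamard_layer_nth mult_if_zero divide_if_zero s eq_commute[of _ bc0] cong: if_cong)
qed

lemma sum_swap_test_initial:
  fixes f g :: "('n::finite, 'd::finite) circ \<Rightarrow> complex"
  shows "(\<Sum>x\<in>UNIV. \<Sum>y\<in>UNIV. f x * swap_test_initial \<rho> \<sigma> $ x $ y * g y) =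
    (\<Sum>bc\<in>UNIV. \<Sum>bc'\<in>UNIV.
      f ((\<lambda>_. False), bc) * kron \<rho> \<sigma> $ bc $ bc' * g ((\<lambda>_. False), bc'))"
proof -
  have "swap_test_initial \<rho> \<sigma> $ (a, bc) $ (a', bc') =
     (if a = (\<lambda>_. False) then if a' = (\<lambda>_. False) then kron \<rho> \<sigma> $ bc $ bc' else 0 else 0)" for a a' bc bc'
    by (simp add: swap_test_initial_def kron_nth tensor_op_def basis_proj_def
        prod_if_zero fun_eq_iff) auto
  then show ?thesis
    unfolding sum_circ by (simp add: mult_if_zero sum_if_zero cong: if_cong)
qed

text \<open>Reindexing by the swap on \<open>S\<close> clears the row label and composes both swaps
  in the column label.\<close>

lemma sum_kron_partial_swap:
  "(\<Sum>bc\<in>UNIV. kron \<rho> \<sigma> $ partial_swap S bc $ partial_swap T bc) = swap_trace \<rho> \<sigma> (sym_diff S T)"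
proof -
  have "(\<Sum>bc\<in>UNIV. kron \<rho> \<sigma> $ partial_swap S bc $ partial_swap T bc) =
    (\<Sum>bc\<in>UNIV. kron \<rho> \<sigma> $ partial_swap S (partial_swap S bc) $ partial_swap T (partial_swap S bc))"
    by (rule sum_partial_swap[symmetric])
  also have "\<dots> = swap_trace \<rho> \<sigma> (sym_diff T S)"
    by (simp add: swap_trace_def) (simp add: partial_swap_partial_swap)
  finally show ?thesis by (simp add: Un_commute)
qed

text \<open>The unitary attaches a signed sum of swaps to the row label, its adjoint does so to the
  column label. After the trace, the signs and the swap trace depend only on the sum in
  \<open>Z_2^n\<close> of the two selecting bit strings.\<close>

lemma swap_test_outcome_trace:
  "trace (kron (tensor_op (\<lambda>i. basis_proj (z i))) (mat 1) ** swap_test_final \<rho> \<sigma>) =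
    (\<Sum>s\<in>UNIV. walsh z s * swap_trace \<rho> \<sigma> {i. s i}) / 2 ^ CARD('n)"
  for \<rho> \<sigma> :: "('n::finite \<Rightarrow> 'd::finite) op"
proof -
  let ?o = "(\<lambda>_. False) :: 'n \<Rightarrow> bool" and ?d = "2 ^ CARD('n) :: complex"
  let ?U = "swap_test_unitary :: ('n, 'd) circ op"
  have "kron (tensor_op (\<lambda>i. basis_proj (z i))) (mat 1) $ (a, bc) $ (a', bc') =
     (if a = z then if a' = z then if bc' = bc then 1 else 0 else 0 else 0)"
    for a a' and bc bc' :: "('n \<Rightarrow> 'd) \<times> ('n \<Rightarrow> 'd)"
    by (simp add: kron_nth tensor_op_def basis_proj_def mat_def prod_if_zero fun_eq_iff)
  then have tr: "trace (kron (tensor_op (\<lambda>i. basis_proj (z i))) (mat 1) ** swap_test_final \<rho> \<sigma>) =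
     (\<Sum>bc\<in>UNIV. swap_test_final \<rho> \<sigma> $ (z, bc) $ (z, bc))"
    unfolding trace_def matrix_matrix_mult_def sum_circ
    by (simp add: mult_if_zero sum_if_zero cong: if_cong)
  have final: "swap_test_final \<rho> \<sigma> $ (z, bc) $ (z, bc) = (\<Sum>s\<in>UNIV. \<Sum>t\<in>UNIV. walsh z s * walsh z t / (?d * ?d) *
     kron \<rho> \<sigma> $ partial_swap {i. s i} bc $ partial_swap {i. t i} bc)" for bc
  proof -
    have "swap_test_final \<rho> \<sigma> $ (z, bc) $ (z, bc) = (\<Sum>y\<in>UNIV. \<Sum>x\<in>UNIV. ?U $ (z, bc) $ x *
        swap_test_initial \<rho> \<sigma> $ x $ y * cnj (?U $ (z, bc) $ y))"
      unfolding swap_test_final_def matrix_matrix_mult_def adjoint_op_def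
      by (simp add: sum_distrib_right)
    also have "\<dots> = (\<Sum>x\<in>UNIV. \<Sum>y\<in>UNIV. ?U $ (z, bc) $ x *
        swap_test_initial \<rho> \<sigma> $ x $ y * cnj (?U $ (z, bc) $ y))"
      by (rule sum.swap)
    also have "\<dots> = (\<Sum>u\<in>UNIV. \<Sum>v\<in>UNIV. \<Sum>s\<in>UNIV. \<Sum>t\<in>UNIV.
        if u = partial_swap {i. s i} bc then if v = partial_swap {i. t i} bc then
        walsh z s * walsh z t / (?d * ?d) * kron \<rho> \<sigma> $ u $ v else 0 else 0)"
      unfolding sum_swap_test_initial swap_test_unitary_nth cnj_sum sum_distrib_right
      unfolding sum_distrib_left
      by (intro sum.cong refl) simp
    also have "\<dots> = (\<Sum>u\<in>UNIV. \<Sum>s\<in>UNIV. \<Sum>v\<in>UNIV. \<Sum>t\<in>UNIV.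
        if u = partial_swap {i. s i} bc then if v = partial_swap {i. t i} bc then
        walsh z s * walsh z t / (?d * ?d) * kron \<rho> \<sigma> $ u $ v else 0 else 0)"
      by (rule sum.cong[OF refl], rule sum.swap)
    also have "\<dots> = (\<Sum>s\<in>UNIV. \<Sum>u\<in>UNIV. \<Sum>t\<in>UNIV. \<Sum>v\<in>UNIV.
        if u = partial_swap {i. s i} bc then if v = partial_swap {i. t i} bc then
        walsh z s * walsh z t / (?d * ?d) * kron \<rho> \<sigma> $ u $ v else 0 else 0)"
      by (subst sum.swap) (intro sum.cong refl sum.swap)
    also have "\<dots> = (\<Sum>s\<in>UNIV. \<Sum>t\<in>UNIV. \<Sum>u\<in>UNIV. if u = partial_swap {i. s i} bc then
        \<Sum>v\<in>UNIV. if v = partial_swap {i. t i} bc then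
        walsh z s * walsh z t / (?d * ?d) * kron \<rho> \<sigma> $ u $ v else 0 else 0)"
      by (rule sum.cong[OF refl], subst sum.swap) (auto intro!: sum.cong)
    finally show ?thesis by simp
  qed
  have "(\<Sum>bc\<in>UNIV. swap_test_final \<rho> \<sigma> $ (z, bc) $ (z, bc)) =
    (\<Sum>s\<in>UNIV. \<Sum>t\<in>UNIV. walsh z s * walsh z t / (?d * ?d) * swap_trace \<rho> \<sigma> (sym_diff {i. s i} {i. t i}))"
    unfolding final sum_kron_partial_swap[symmetric] sum_distrib_left
    by (subst sum.swap, rule sum.cong[OF refl], rule sum.swap)
  \<comment> \<open>For fixed \<open>s\<close>, adding \<open>s\<close> to \<open>t\<close> in
    \<open>Z_2^n\<close> is an involution that removes \<open>s\<close> from the summand. The sum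
    over \<open>s\<close> then has \<open>2^n\<close> equal terms, which cancel one factor
    \<open>?d\<close>.\<close>
  also have "\<dots> = (\<Sum>s\<in>(UNIV :: ('n \<Rightarrow> bool) set). \<Sum>t\<in>UNIV. walsh z t / (?d * ?d) * swap_trace \<rho> \<sigma> {i. t i})"
  proof (rule sum.cong[OF refl])
    fix s :: "'n \<Rightarrow> bool"
    show "(\<Sum>t\<in>UNIV. walsh z s * walsh z t / (?d * ?d) * swap_trace \<rho> \<sigma> (sym_diff {i. s i} {i. t i})) =
      (\<Sum>t\<in>UNIV. walsh z t / (?d * ?d) * swap_trace \<rho> \<sigma> {i. t i})"
      by (rule sum.reindex_bij_witness[of _ "\<lambda>t i. s i \<noteq> t i" "\<lambda>t i. s i \<noteq> t i"])
        (auto simp: walsh_mult intro!: arg_cong[where f = "swap_trace \<rho> \<sigma>"])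
  qed
  also have "\<dots> = (\<Sum>s\<in>UNIV. walsh z s * swap_trace \<rho> \<sigma> {i. s i}) / ?d"
    by (simp add: card_fun sum_divide_distrib sum_distrib_left)
  finally show ?thesis
    by (simp add: tr)
qed

text \<open>Orthogonality of the characters inverts the transform and cancels \<open>2^n\<close>.
  The signs are real, so the real part from Born's rule can be taken last.\<close>

lemma walsh_swap_test_prob:
  "(\<Sum>z\<in>UNIV. (-1) ^ dot z t * swap_test_prob \<rho> \<sigma> z) = Re (swap_trace \<rho> \<sigma> {i. t i})"
  for \<rho> \<sigma> :: "('n::finite \<Rightarrow> 'd::finite) op"
proof -
  let ?d = "2 ^ CARD('n) :: complex"
  have re: "(-1) ^ m * Re x = Re ((-1) ^ m * x)" for m x
    by (cases "even m") auto
  have "(\<Sum>z\<in>UNIV. (-1) ^ dot z t * swap_test_prob \<rho> \<sigma> z) =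
    Re (\<Sum>z\<in>UNIV. walsh z t * ((\<Sum>s\<in>UNIV. walsh z s * swap_trace \<rho> \<sigma> {i. s i}) / ?d))"
    unfolding swap_test_prob_def swap_test_outcome_trace re walsh_eq_dot Re_sum ..
  also have "(\<Sum>z\<in>UNIV. walsh z t * ((\<Sum>s\<in>UNIV. walsh z s * swap_trace \<rho> \<sigma> {i. s i}) / ?d)) =
    (\<Sum>s\<in>UNIV. (\<Sum>z\<in>UNIV. walsh z s * walsh z t) * swap_trace \<rho> \<sigma> {i. s i} / ?d)"
    unfolding sum_distrib_left sum_divide_distrib sum_distrib_right
    by (subst sum.swap) (simp add: mult_ac)
  also have "\<dots> = (\<Sum>s\<in>UNIV. if s = t then swap_trace \<rho> \<sigma> {i. s i} else 0)"
    unfolding walsh_orthogonal by (intro sum.cong) auto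
  finally show ?thesis by simp
qed


section \<open>Completeness of the error basis\<close>

text \<open>\<open>M\<close> is the matrix unit at \<open>(x', y')\<close>. Orthogonality gives its
  coefficients as \<open>cnj (e j $ x' $ y') / d\<close>, and the expansion is read at
  \<open>(x, y)\<close>.\<close>

lemma error_basis_complete:
  fixes e :: "nat \<Rightarrow> ('d::finite) op"
  assumes "is_error_basis e"
  shows "(\<Sum>j<CARD('d)\<^sup>2. e j $ x $ y * cnj (e j $ x' $ y')) =
    (if x = x' \<and> y = y' then of_nat CARD('d) else 0)"
proof -
  let ?D = "CARD('d)\<^sup>2" and ?d = "of_nat CARD('d) :: complex"
  define M :: "'d op" where "M = (\<chi> a b. if a = x' \<and> b = y' then 1 else 0)"
  obtain c where c: "\<And>a b. M $ a $ b = (\<Sum>j<?D. c j * e j $ a $ b)"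
    using assms unfolding is_error_basis_def by metis
  have orth: "(\<Sum>b\<in>UNIV. \<Sum>a\<in>UNIV. cnj (e j $ a $ b) * e j' $ a $ b) = (if j = j' then ?d else 0)"
    if "j < ?D" "j' < ?D" for j j'
    using assms that unfolding is_error_basis_def
    by (simp add: trace_def matrix_matrix_mult_def adjoint_op_def)
  have coeff: "cnj (e j $ x' $ y') = c j * ?d" if j: "j < ?D" for j
  proof -
    have "cnj (e j $ x' $ y') = (\<Sum>b\<in>UNIV. \<Sum>a\<in>UNIV. cnj (e j $ a $ b) * M $ a $ b)"
      by (simp add: M_def if_conj_zero mult_if_zero sum_if_zero cong: if_cong)
    also have "\<dots> = (\<Sum>b\<in>UNIV. \<Sum>a\<in>UNIV. \<Sum>j'<?D. c j' * (cnj (e j $ a $ b) * e j' $ a $ b))"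
      by (simp add: c sum_distrib_left mult_ac)
    also have "\<dots> = (\<Sum>j'<?D. c j' * (\<Sum>b\<in>UNIV. \<Sum>a\<in>UNIV. cnj (e j $ a $ b) * e j' $ a $ b))"
      unfolding sum_distrib_left sum.swap[where B = "{..<?D}"] ..
    also have "\<dots> = (\<Sum>j'<?D. if j = j' then c j' * ?d else 0)"
      by (intro sum.cong) (auto simp: orth j)
    finally show ?thesis
      using j by simp
  qed
  have "(\<Sum>j<?D. e j $ x $ y * cnj (e j $ x' $ y')) = M $ x $ y * ?d"
    by (simp add: c coeff sum_distrib_left sum_distrib_right mult_ac)
  then show ?thesis
    by (simp add: M_def)
qed

text \<open>Two distinct indices of the identity would be orthogonal, yet its trace \<open>d\<close>
  is nonzero. Hence the support of an error can be read off its indices.\<close>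

lemma error_basis_one:
  fixes e :: "nat \<Rightarrow> ('d::finite) op"
  assumes "is_error_basis e"
  obtains j0 where "j0 < CARD('d)\<^sup>2" "\<And>j. j < CARD('d)\<^sup>2 \<Longrightarrow> e j = mat 1 \<longleftrightarrow> j = j0"
proof -
  obtain j0 where j0: "j0 < CARD('d)\<^sup>2" "e j0 = mat 1"
    using assms unfolding is_error_basis_def by blast
  have orth: "trace (adjoint_op (e j) ** e j') = (if j = j' then of_nat CARD('d) else 0)"
    if "j < CARD('d)\<^sup>2" "j' < CARD('d)\<^sup>2" for j j'
    using assms that unfolding is_error_basis_def by blast
  have "j = j0" if "j < CARD('d)\<^sup>2" "e j = mat 1" for j
    using orth[of j0 j0] orth[OF that(1) j0(1)] j0 that by (auto split: if_splits)
  with j0 that show thesis by blast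
qed

section \<open>Sums over errors supported within a set of sites\<close>

definition errors_within :: "(nat \<Rightarrow> ('d::finite) op) \<Rightarrow> 'n set \<Rightarrow> ('n::finite \<Rightarrow> nat) set" where
  "errors_within e T = {\<alpha>. (\<forall>i. \<alpha> i < CARD('d)\<^sup>2) \<and> {i. e (\<alpha> i) \<noteq> mat 1} \<subseteq> T}"

text \<open>
  The condition on the right says that \<open>x = x'\<close>, \<open>y = y'\<close> on \<open>T\<close>, and \<open>x = y\<close>, \<open>x' = y'\<close> off \<open>T\<close>; solved
  for \<open>x\<close> and \<open>y'\<close> it collapses those two sums in the traces.
\<close>

lemma sum_errors_within:
  fixes e :: "nat \<Rightarrow> ('d::finite) op" and T :: "'n::finite set"
  assumes "is_error_basis e"
  shows "(\<Sum>\<alpha>\<in>errors_within e T. err e \<alpha> $ x $ y * cnj (err e \<alpha> $ x' $ y')) =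
    (if x = join T x' y \<and> y' = join T y x' then of_nat CARD('d) ^ card T else 0)"
proof -
  let ?D = "CARD('d)\<^sup>2" and ?d = "of_nat CARD('d) :: complex"
  obtain j0 where j0: "j0 < ?D" "\<And>j. j < ?D \<Longrightarrow> e j = mat 1 \<longleftrightarrow> j = j0"
    using error_basis_one[OF assms] by blast
  \<comment> \<open>The set is a box: all indices on \<open>T\<close>, only that of the identity off
    \<open>T\<close>. The sum of products thus becomes a product of sums.\<close>
  have "errors_within e T = PiE UNIV (\<lambda>i. if i \<in> T then {..<?D} else {j0})"
    using j0 by (fastforce simp: errors_within_def split: if_splits)
  then have "(\<Sum>\<alpha>\<in>errors_within e T. err e \<alpha> $ x $ y * cnj (err e \<alpha> $ x' $ y')) =
    (\<Prod>i\<in>UNIV. \<Sum>j\<in>(if i \<in> T then {..<?D} else {j0}). e j $ x i $ y i * cnj (e j $ x' i $ y' i))"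
    by (simp add: err_def tensor_op_def prod_sum_PiE prod.distrib)
  also have "\<dots> = (\<Prod>i\<in>UNIV. if x i = join T x' y i \<and> y' i = join T y x' i then (if i \<in> T then ?d else 1) else 0)"
  proof (rule prod.cong[OF refl])
    fix i
    have "e j0 = mat 1"
      using j0 by blast
    then show "(\<Sum>j\<in>(if i \<in> T then {..<?D} else {j0}). e j $ x i $ y i * cnj (e j $ x' i $ y' i)) =
      (if x i = join T x' y i \<and> y' i = join T y x' i then (if i \<in> T then ?d else 1) else 0)"
      by (cases "i \<in> T") (auto simp: error_basis_complete[OF assms] join_def mat_def)
  qed
  also have "\<dots> = (if x = join T x' y \<and> y' = join T y x' then ?d ^ card T else 0)"
    by (auto simp: prod_if_zero fun_eq_iff prod.If_cases)
  finally show ?thesis .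
qed

text \<open>Both enumerators are linear in the error and in its conjugate; \<open>g\<close> collects
  the entries of \<open>\<rho>\<close>. The sums over \<open>x\<close> and \<open>y'\<close> stand
  innermost because the conditions determine these labels.\<close>

lemma sum_errors_within_form:
  fixes e :: "nat \<Rightarrow> ('d::finite) op" and T :: "'n::finite set"
  assumes "is_error_basis e"
  shows "(\<Sum>\<alpha>\<in>errors_within e T. \<Sum>y\<in>UNIV. \<Sum>x'\<in>UNIV. \<Sum>x\<in>UNIV. \<Sum>y'\<in>UNIV.
      err e \<alpha> $ x $ y * cnj (err e \<alpha> $ x' $ y') * g x y x' y') =
    of_nat CARD('d) ^ card T * (\<Sum>y\<in>UNIV. \<Sum>x'\<in>UNIV. g (join T x' y) y x' (join T y x'))"
  unfolding sum.swap[where A = "errors_within e T"] sum_distrib_right[symmetric]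
    sum_errors_within[OF assms]
  by (simp add: if_conj_zero mult_if_zero sum_if_zero sum_distrib_left cong: if_cong)

text \<open>Here \<open>g\<close> becomes
  \<open>\<rho> $ y $ join T x' y * \<rho> $ x' $ join T y x'\<close>, with \<open>y\<close> and
  \<open>x'\<close> swapped on \<open>T\<close>.\<close>

lemma sum_errors_within_A:
  fixes e :: "nat \<Rightarrow> ('d::finite) op" and \<rho> :: "('n::finite \<Rightarrow> 'd) op"
  assumes "is_error_basis e"
  shows "(\<Sum>\<alpha>\<in>errors_within e T. trace (err e \<alpha> ** \<rho>) * trace (adjoint_op (err e \<alpha>) ** \<rho>)) =
    of_nat CARD('d) ^ card T * swap_trace \<rho> \<rho> T"
proof -
  have "trace (E ** \<rho>) * trace (adjoint_op E ** \<rho>) =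
    (\<Sum>y\<in>UNIV. \<Sum>x'\<in>UNIV. \<Sum>x\<in>UNIV. \<Sum>y'\<in>UNIV. E $ x $ y * cnj (E $ x' $ y') * (\<rho> $ y $ x * \<rho> $ x' $ y'))" for E
  proof -
    have "trace (E ** \<rho>) = (\<Sum>y\<in>UNIV. \<Sum>x\<in>UNIV. E $ x $ y * \<rho> $ y $ x)"
      by (simp add: trace_def matrix_matrix_mult_def) (rule sum.swap)
    moreover have "trace (adjoint_op E ** \<rho>) = (\<Sum>x'\<in>UNIV. \<Sum>y'\<in>UNIV. cnj (E $ x' $ y') * \<rho> $ x' $ y')"
      by (simp add: trace_def matrix_matrix_mult_def adjoint_op_def) (rule sum.swap)
    ultimately show ?thesis
      by (simp add: sum_product mult_ac)
  qed
  then show ?thesis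
    by (simp add: sum_errors_within_form[OF assms] swap_trace_explicit)
qed

text \<open>The first \<open>\<rho>\<close> now links \<open>y\<close> to \<open>y'\<close>, so
  \<open>g\<close> becomes \<open>\<rho> $ y $ join T y x' * \<rho> $ x' $ join T x' y\<close>. This
  keeps \<open>y\<close> on \<open>T\<close> and swaps on \<open>- T\<close>.\<close>

lemma sum_errors_within_B:
  fixes e :: "nat \<Rightarrow> ('d::finite) op" and \<rho> :: "('n::finite \<Rightarrow> 'd) op"
  assumes "is_error_basis e"
  shows "(\<Sum>\<alpha>\<in>errors_within e T. trace (err e \<alpha> ** \<rho> ** adjoint_op (err e \<alpha>) ** \<rho>)) =
    of_nat CARD('d) ^ card T * swap_trace \<rho> \<rho> (- T)"
proof -
  have "trace (E ** \<rho> ** adjoint_op E ** \<rho>) =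
    (\<Sum>y\<in>UNIV. \<Sum>x'\<in>UNIV. \<Sum>x\<in>UNIV. \<Sum>y'\<in>UNIV. E $ x $ y * cnj (E $ x' $ y') * (\<rho> $ y $ y' * \<rho> $ x' $ x))" for E
  proof -
    let ?h = "\<lambda>x y x' y'. E $ x $ y * cnj (E $ x' $ y') * (\<rho> $ y $ y' * \<rho> $ x' $ x)"
    have "trace (E ** \<rho> ** adjoint_op E ** \<rho>) = (\<Sum>x\<in>UNIV. \<Sum>x'\<in>UNIV. \<Sum>y'\<in>UNIV. \<Sum>y\<in>UNIV. ?h x y x' y')"
      unfolding trace_def matrix_matrix_mult_def adjoint_op_def
      by (simp add: sum_distrib_right) (simp add: mult_ac)
    also have "\<dots> = (\<Sum>x\<in>UNIV. \<Sum>x'\<in>UNIV. \<Sum>y\<in>UNIV. \<Sum>y'\<in>UNIV. ?h x y x' y')"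
      by (intro sum.cong refl sum.swap)
    also have "\<dots> = (\<Sum>x\<in>UNIV. \<Sum>y\<in>UNIV. \<Sum>x'\<in>UNIV. \<Sum>y'\<in>UNIV. ?h x y x' y')"
      by (rule sum.cong[OF refl], rule sum.swap)
    also have "\<dots> = (\<Sum>y\<in>UNIV. \<Sum>x\<in>UNIV. \<Sum>x'\<in>UNIV. \<Sum>y'\<in>UNIV. ?h x y x' y')"
      by (rule sum.swap)
    also have "\<dots> = (\<Sum>y\<in>UNIV. \<Sum>x'\<in>UNIV. \<Sum>x\<in>UNIV. \<Sum>y'\<in>UNIV. ?h x y x' y')"
      by (rule sum.cong[OF refl], rule sum.swap)
    finally show ?thesis .
  qed
  moreover have "join (- T) b c = join T c b" for b c :: "'n \<Rightarrow> 'd"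
    by (auto simp: join_def)
  ultimately show ?thesis
    by (simp add: sum_errors_within_form[OF assms] swap_trace_explicit)
qed

section \<open>Moebius inversion over sets of sites\<close>

lemma card_uminus: "card (- T) = CARD('n) - card T" for T :: "'n::finite set"
  by (simp add: Compl_eq_Diff_UNIV card_Diff_subset)

lemma card_supersets:
  fixes T :: "'n::finite set"
  assumes "card T \<le> j"
  shows "card {S. card S = j \<and> T \<subseteq> S} = (CARD('n) - card T) choose (j - card T)"
proof -
  have "bij_betw (\<lambda>S. S - T) {S. card S = j \<and> T \<subseteq> S} {R. R \<subseteq> - T \<and> card R = j - card T}"
  proof (rule bij_betw_byWitness[where f' = "\<lambda>R. R \<union> T"])
    show "(\<lambda>R. R \<union> T) ` {R. R \<subseteq> - T \<and> card R = j - card T} \<subseteq> {S. card S = j \<and> T \<subseteq> S}"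
      using assms by (auto simp: card_Un_disjoint disjoint_eq_subset_Compl)
  qed (auto simp: card_Diff_subset)
  then have "card {S. card S = j \<and> T \<subseteq> S} = card {R. R \<subseteq> - T \<and> card R = j - card T}"
    by (rule bij_betw_same_card)
  also have "\<dots> = card (- T) choose (j - card T)"
    by (rule n_subsets) simp
  finally show ?thesis
    by (simp add: card_uminus)
qed

text \<open>After inversion the sums are exchanged. A set \<open>T\<close> of size
  \<open>k \<le> j\<close> then occurs once for each superset of size \<open>j\<close>, which
  produces the binomial coefficient, and the sets are grouped by size.\<close>

lemma sum_card_mobius:
  fixes f F :: "'n::finite set \<Rightarrow> 'a::comm_ring_1"
  assumes F: "\<And>T. F T = (\<Sum>S\<in>Pow T. f S)"
  shows "(\<Sum>S | card S = j. f S) =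
    (\<Sum>k=0..j. (-1) ^ (j - k) * of_nat ((CARD('n) - k) choose (j - k)) * (\<Sum>T | card T = k. F T))"
proof -
  have mobius: "f S = (\<Sum>T\<in>Pow S. (-1) ^ (card S - card T) * F T)" for S
    by (rule inclusion_exclusion_mobius) (simp_all add: F)
  have "(\<Sum>S | card S = j. f S) = (\<Sum>S | card S = j. \<Sum>T | T \<subseteq> S. (-1) ^ (j - card T) * F T)"
    by (intro sum.cong refl) (simp add: mobius[of _] Pow_def)
  also have "\<dots> = (\<Sum>(S, T) | card S = j \<and> T \<subseteq> S. (-1) ^ (j - card T) * F T)"
    by (subst sum.Sigma) (auto intro!: sum.cong)
  also have "\<dots> = (\<Sum>(T, S)\<in>Sigma {T. card T \<le> j} (\<lambda>T. {S. card S = j \<and> T \<subseteq> S}). (-1) ^ (j - card T) * F T)"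
    by (rule sum.reindex_bij_witness[of _ "\<lambda>(T, S). (S, T)" "\<lambda>(S, T). (T, S)"]) (auto intro: card_mono)
  also have "\<dots> = (\<Sum>T | card T \<le> j. \<Sum>S | card S = j \<and> T \<subseteq> S. (-1) ^ (j - card T) * F T)"
    by (subst sum.Sigma) auto
  also have "\<dots> = (\<Sum>T | card T \<le> j. (-1) ^ (j - card T) * of_nat ((CARD('n) - card T) choose (j - card T)) * F T)"
    by (intro sum.cong refl) (simp add: card_supersets mult_ac)
  also have "\<dots> = (\<Sum>k=0..j. \<Sum>T | T \<in> {T. card T \<le> j} \<and> card T = k.
      (-1) ^ (j - card T) * of_nat ((CARD('n) - card T) choose (j - card T)) * F T)"
    by (rule sum.group[symmetric]) auto
  also have "\<dots> = (\<Sum>k=0..j. (-1) ^ (j - k) * of_nat ((CARD('n) - k) choose (j - k)) * (\<Sum>T | card T = k. F T))"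
    by (intro sum.cong refl) (auto simp: sum_distrib_left intro!: sum.cong)
  finally show ?thesis .
qed

text \<open>The inversion is applied to the partial sums over errors whose support is exactly
  \<open>S\<close>.\<close>

lemma sum_err_wt:
  fixes e :: "nat \<Rightarrow> ('d::finite) op" and g :: "('n::finite \<Rightarrow> nat) \<Rightarrow> complex"
  assumes F: "\<And>T. (\<Sum>\<alpha>\<in>errors_within e T. g \<alpha>) = of_nat CARD('d) ^ card T * G T"
  shows "(\<Sum>\<alpha> | (\<forall>i. \<alpha> i < CARD('d)\<^sup>2) \<and> err_wt e \<alpha> = j. g \<alpha>) =
    (\<Sum>k=0..j. (-1) ^ (j - k) * of_nat ((CARD('n) - k) choose (j - k)) * of_nat CARD('d) ^ k *
       (\<Sum>T | card T = k. G T))"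
proof -
  let ?supp = "\<lambda>\<alpha>. {i. e (\<alpha> i) \<noteq> mat 1}"
  let ?V = "{\<alpha> :: 'n \<Rightarrow> nat. \<forall>i. \<alpha> i < CARD('d)\<^sup>2}"
  let ?f = "\<lambda>S. \<Sum>\<alpha> | \<alpha> \<in> ?V \<and> ?supp \<alpha> = S. g \<alpha>"
  \<comment> \<open>The type of index functions is infinite; the bound on the values supplies the
    finiteness that regrouping requires.\<close>
  have "?V = PiE UNIV (\<lambda>_. {..<CARD('d)\<^sup>2})"
    by auto
  then have fin: "finite ?V"
    by (metis finite_PiE finite_lessThan finite_class.finite_UNIV)
  have group: "(\<Sum>\<alpha> | \<alpha> \<in> ?V \<and> ?supp \<alpha> \<in> X. g \<alpha>) = (\<Sum>S\<in>X. ?f S)" for X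
  proof -
    have "(\<Sum>S\<in>X. ?f S) = (\<Sum>S\<in>X. \<Sum>\<alpha> | \<alpha> \<in> {\<alpha> \<in> ?V. ?supp \<alpha> \<in> X} \<and> ?supp \<alpha> = S. g \<alpha>)"
      by (intro sum.cong refl) auto
    also have "\<dots> = (\<Sum>\<alpha> | \<alpha> \<in> ?V \<and> ?supp \<alpha> \<in> X. g \<alpha>)"
      by (rule sum.group) (use fin in auto)
    finally show ?thesis ..
  qed
  have "(\<Sum>\<alpha> | (\<forall>i. \<alpha> i < CARD('d)\<^sup>2) \<and> err_wt e \<alpha> = j. g \<alpha>) = (\<Sum>S | card S = j. ?f S)"
    using group[of "{S. card S = j}"] by (simp add: err_wt_def)
  also have "\<dots> = (\<Sum>k=0..j. (-1) ^ (j - k) * of_nat ((CARD('n) - k) choose (j - k)) *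
      (\<Sum>T | card T = k. of_nat CARD('d) ^ card T * G T))"
  proof (rule sum_card_mobius)
    show "of_nat CARD('d) ^ card T * G T = (\<Sum>S\<in>Pow T. ?f S)" for T
      using group[of "Pow T"] by (simp add: F[symmetric] errors_within_def)
  qed
  moreover have "(\<Sum>T | card T = k. of_nat CARD('d) ^ card T * G T) =
      of_nat CARD('d) ^ k * (\<Sum>T | card T = k. G T)" for k
    by (simp add: sum_distrib_left)
  ultimately show ?thesis
    by (simp add: mult.assoc)
qed

section \<open>Bit strings as sets of sites, and the four enumerators\<close>

lemma sum_wt_eq:
  fixes f :: "'n::finite set \<Rightarrow> 'a::comm_monoid_add"
  shows "(\<Sum>t | wt t = k. f {i. t i}) = (\<Sum>T | card T = k. f T)"
  by (rule sum.reindex_bij_witness[of _ "\<lambda>T i. i \<in> T" "\<lambda>t. {i. t i}"]) (auto simp: wt_def)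

text \<open>Complementation is the reindexing. The bound on \<open>k\<close> matters: truncated
  subtraction would turn any larger \<open>k\<close> into weight 0.\<close>

lemma sum_wt_eq_compl:
  fixes f :: "'n::finite set \<Rightarrow> 'a::comm_monoid_add"
  assumes "k \<le> CARD('n)"
  shows "(\<Sum>t | wt t = CARD('n) - k. f {i. t i}) = (\<Sum>T | card T = k. f (- T))"
proof -
  have card: "card T \<le> CARD('n)" for T :: "'n set"
    by (rule card_mono) auto
  show ?thesis
    unfolding sum_wt_eq
    by (rule sum.reindex_bij_witness[of _ uminus uminus])
      (use assms card in \<open>auto simp: card_uminus\<close>)
qed



theorem theorem9:
  fixes e :: "nat \<Rightarrow> ('d::finite) op"
    and Q :: "('n::finite, 'd) hilb set"
    and K \<delta> j :: nat
    and \<rho> :: "('n \<Rightarrow> 'd) op"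
    and p :: "('n \<Rightarrow> bool) \<Rightarrow> real"
  assumes "is_error_basis e"
    and "is_qecc e Q K \<delta>"
    and "\<rho> = normalized_projector Q"
    and "p = swap_test_prob \<rho> \<rho>"
    and "j \<le> CARD('n)"
  shows "SL_A e \<rho> j = complex_of_real
           (\<Sum>k=0..j. (-1) ^ (j - k) * real ((CARD('n) - k) choose (j - k)) * real CARD('d) ^ k *
              (\<Sum>t | wt t = k. \<Sum>z\<in>UNIV. (-1) ^ dot z t * p z)) \<and>
         SL_B e \<rho> j = complex_of_real
           (\<Sum>k=0..j. (-1) ^ (j - k) * real ((CARD('n) - k) choose (j - k)) * real CARD('d) ^ k *
              (\<Sum>t | wt t = CARD('n) - k. \<Sum>z\<in>UNIV. (-1) ^ dot z t * p z)) \<and>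
         rains_A \<rho> j = complex_of_real
           (\<Sum>t | wt t = j. \<Sum>z\<in>UNIV. (-1) ^ dot z t * p z) \<and>
         rains_B \<rho> j = complex_of_real
           (\<Sum>t | wt t = CARD('n) - j. \<Sum>z\<in>UNIV. (-1) ^ dot z t * p z)"
proof -
  have "vec.subspace Q"
    using assms(2) by (simp add: is_qecc_def)
  \<comment> \<open>The enumerators are complex while the probabilities are real; self-adjointness
    of \<open>\<rho>\<close> lets \<open>Re\<close> be dropped.\<close>
  then have real: "complex_of_real (Re (swap_trace \<rho> \<rho> T)) = swap_trace \<rho> \<rho> T" for T
    by (simp add: swap_trace_real assms(3) adjoint_normalized_projector)
  have p: "(\<Sum>z\<in>UNIV. (-1) ^ dot z t * p z) = Re (swap_trace \<rho> \<rho> {i. t i})" for t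
    unfolding assms(4) by (rule walsh_swap_test_prob)
  have wt: "complex_of_real (\<Sum>t | wt t = k. \<Sum>z\<in>UNIV. (-1) ^ dot z t * p z) =
      (\<Sum>T | card T = k. swap_trace \<rho> \<rho> T)" for k
    by (simp add: p real) (rule sum_wt_eq)
  have wt': "complex_of_real (\<Sum>t | wt t = CARD('n) - k. \<Sum>z\<in>UNIV. (-1) ^ dot z t * p z) =
      (\<Sum>T | card T = k. swap_trace \<rho> \<rho> (- T))" if "k \<le> CARD('n)" for k
    by (simp add: p real) (rule sum_wt_eq_compl[OF that])
  show ?thesis
  proof (intro conjI)
    show "SL_A e \<rho> j = complex_of_real
        (\<Sum>k=0..j. (-1) ^ (j - k) * real ((CARD('n) - k) choose (j - k)) * real CARD('d) ^ k *
          (\<Sum>t | wt t = k. \<Sum>z\<in>UNIV. (-1) ^ dot z t * p z))"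
      unfolding SL_A_def sum_err_wt[OF sum_errors_within_A[OF assms(1)]] of_real_sum[of _ "{0..j}"]
        of_real_mult wt by simp
    show "SL_B e \<rho> j = complex_of_real
        (\<Sum>k=0..j. (-1) ^ (j - k) * real ((CARD('n) - k) choose (j - k)) * real CARD('d) ^ k *
          (\<Sum>t | wt t = CARD('n) - k. \<Sum>z\<in>UNIV. (-1) ^ dot z t * p z))"
      unfolding SL_B_def sum_err_wt[OF sum_errors_within_B[OF assms(1)]] of_real_sum[of _ "{0..j}"]
        of_real_mult
      \<comment> \<open>The bound that \<open>wt'\<close> asks for comes from
        \<open>k \<le> j\<close> and \<open>j \<le> CARD('n)\<close>.\<close>
      by (intro sum.cong refl, subst wt') (use assms(5) in auto)
    show "rains_A \<rho> j = complex_of_real (\<Sum>t | wt t = j. \<Sum>z\<in>UNIV. (-1) ^ dot z t * p z)"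
      by (simp only: rains_A_def purity_eq_swap_trace wt)
    show "rains_B \<rho> j = complex_of_real (\<Sum>t | wt t = CARD('n) - j. \<Sum>z\<in>UNIV. (-1) ^ dot z t * p z)"
      by (simp only: rains_B_def purity_eq_swap_trace wt'[OF assms(5)])
  qed
qed

end
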